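(* Let $\mathbb I\in\{\mathbb Z,\mathbb Q,\mathbb R\}$, let $\mathcal M$ be the set of $n\times n$ difference-bound matrices over $\overline{\mathbb I}$, and let $\mathcal M_\bot=\mathcal M\cup\{\bot\}$ with the structure described in the context. Then: 1. $(\mathcal M_\bot,\sqsubseteq,\sqcap,\sqcup,\bot,\top)$ is a lattice (with least element $\bot$ and greatest element $\top$). 2. This lattice is complete if $(\mathbb I,\leq)$ is complete (i.e. if $\mathbb I$ is $\mathbb Z$ or $\mathbb R$, but not $\mathbb Q$).
   Context: Let $\overline{\mathbb I}=\mathbb I\cup\{+\infty\}$ with the usual extended order. A difference-bound matrix (DBM) is an $n\times n$ matrix with entries in $\overline{\mathbb I}$. On $\mathcal M$: $\vec m\trianglelefteq\vec n$ iff $\vec m_{ij}\leq\vec n_{ij}$ for all $i,j$; $(\vec m\vee\vec n)_{ij}=\max(\vec m_{ij},\vec n_{ij})$; $(\vec m\wedge\vec n)_{ij}=\min(\vec m_{ij},\vec n_{ij})$. These are extended to $\mathcal M_\bot=\mathcal M\cup\{\bot\}$, where $\bot$ is a new element, into $\sqsubseteq,\sqcup,\sqcap$ by making $\bot$ the least element: $\vec m\sqsubseteq\vec n$ iff $\vec m=\bot$, or $\vec m,\vec n\in\mathcal M$ and $\vec m\trianglelefteq\vec n$; $\bot\sqcup\vec m=\vec m\sqcup\bot=\vec m$; $\bot\sqcap\vec m=\vec m\sqcap\bot=\bot$; and $\sqcup,\sqcap$ coincide with $\vee,\wedge$ on $\mathcal M$. The element $\top$ is the DBM with all entries equal to $+\infty$.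 "$(\mathbb I,\leq)$ complete" means that every non-empty subset of $\mathbb I$ bounded above has a least upper bound in $\mathbb I$. *)

theory Defs
  imports "HOL-Analysis.Analysis" "HOL-Algebra.Complete_Lattice"
begin

text \<open>
  The number domain is a subset \<open>I\<close> of the reals (\<open>\<int>\<close>, \<open>\<rat>\<close> or \<open>UNIV\<close>), so its extension by
  \<open>+\<infinity>\<close>, with the usual order, is a subset of \<^typ>\<open>ereal\<close> that does not contain \<open>-\<infinity>\<close>.
\<close>

definition extend_inf :: "real set \<Rightarrow> ereal set" where
  "extend_inf I = ereal ` I \<union> {\<infinity>}"

definition dbms :: "real set \<Rightarrow> (ereal ^ 'n ^ 'n) set" where
  "dbms I = {m. \<forall>i j. m $ i $ j \<in> extend_inf I}"

definition dbm_le :: "ereal ^ 'n ^ 'n \<Rightarrow> ereal ^ 'n ^ 'n \<Rightarrow> bool" where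
  "dbm_le m n \<longleftrightarrow> (\<forall>i j. m $ i $ j \<le> n $ i $ j)"

definition dbm_max :: "ereal ^ 'n ^ 'n \<Rightarrow> ereal ^ 'n ^ 'n \<Rightarrow> ereal ^ 'n ^ 'n" where
  "dbm_max m n = (\<chi> i j. max (m $ i $ j) (n $ i $ j))"

definition dbm_min :: "ereal ^ 'n ^ 'n \<Rightarrow> ereal ^ 'n ^ 'n \<Rightarrow> ereal ^ 'n ^ 'n" where
  "dbm_min m n = (\<chi> i j. min (m $ i $ j) (n $ i $ j))"

text \<open>The additional least element \<open>\<bottom>\<close> is \<^const>\<open>None\<close>.\<close>

fun dbm_bot_le :: "(ereal ^ 'n ^ 'n) option \<Rightarrow> (ereal ^ 'n ^ 'n) option \<Rightarrow> bool" where
  "dbm_bot_le None _ = True"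
| "dbm_bot_le (Some m) None = False"
| "dbm_bot_le (Some m) (Some n) = dbm_le m n"

fun dbm_bot_join ::
  "(ereal ^ 'n ^ 'n) option \<Rightarrow> (ereal ^ 'n ^ 'n) option \<Rightarrow> (ereal ^ 'n ^ 'n) option" where
  "dbm_bot_join None y = y"
| "dbm_bot_join (Some m) None = Some m"
| "dbm_bot_join (Some m) (Some n) = Some (dbm_max m n)"

fun dbm_bot_meet ::
  "(ereal ^ 'n ^ 'n) option \<Rightarrow> (ereal ^ 'n ^ 'n) option \<Rightarrow> (ereal ^ 'n ^ 'n) option" where
  "dbm_bot_meet None _ = None"
| "dbm_bot_meet (Some m) None = None"
| "dbm_bot_meet (Some m) (Some n) = Some (dbm_min m n)"

definition dbm_top :: "(ereal ^ 'n ^ 'n) option" where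
  "dbm_top = Some (\<chi> i j. \<infinity>)"

definition dbm_order :: "real set \<Rightarrow> (ereal ^ 'n ^ 'n) option gorder" where
  "dbm_order I = \<lparr>carrier = insert None (Some ` dbms I), eq = (=), le = dbm_bot_le\<rparr>"

text \<open>Both the upper bound in the hypothesis and the least upper bound are sought in \<open>I\<close> itself.\<close>

definition lub_complete :: "real set \<Rightarrow> bool" where
  "lub_complete I \<longleftrightarrow>
    (\<forall>S. S \<subseteq> I \<and> S \<noteq> {} \<and> (\<exists>b\<in>I. \<forall>x\<in>S. x \<le> b) \<longrightarrow>
      (\<exists>l\<in>I. (\<forall>x\<in>S. x \<le> l) \<and> (\<forall>u\<in>I. (\<forall>x\<in>S. x \<le> u) \<longrightarrow> l \<le> u)))"

end

theory Submission
  imports Defs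
begin

text \<open>
  Everything is entrywise. The extended domain has all suprema of non-empty sets if \<open>I\<close> is
  complete: a set without upper bound in \<open>I\<close> has supremum \<open>\<infinity>\<close>. The new element \<open>\<bottom>\<close> supplies the
  supremum of the empty set. Conversely, constant matrices embed \<open>I\<close> into the lattice, so a
  complete lattice forces \<open>I\<close> to be complete, and \<open>\<rat>\<close> is not: the rationals below an irrational
  number have no least rational upper bound.
\<close>

text \<open>The infimum of \<open>A\<close> is the supremum \<open>s\<close> of its set of lower
  bounds: each element of \<open>A\<close> bounds that set from above, so \<open>s\<close> lies
  below it. Hence only suprema have to be constructed, including that of the empty set.\<close>

lemma (in partial_order) complete_lattice_if_lubs:
  assumes lub: "\<And>A. A \<subseteq> carrier L \<Longrightarrow> \<exists>s. is_lub L s A"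
  shows "complete_lattice L"
proof
  fix A assume A: "A \<subseteq> carrier L"
  show "\<exists>s. is_lub L s A" by (rule lub[OF A])
  obtain s where s: "is_lub L s (Lower L A)"
    using lub[of "Lower L A"] by auto
  have "is_glb L s A"
  proof (rule greatest_LowerI)
    fix x assume "x \<in> A"
    then have "x \<in> Upper L (Lower L A)"
      using A by (auto intro!: Upper_memI)
    then show "s \<sqsubseteq> x" by (rule least_le[OF s])
  next
    fix y assume "y \<in> Lower L A"
    then show "y \<sqsubseteq> s" by (intro least_Upper_above[OF s]) auto
  qed (use A s in auto)
  then show "\<exists>i. is_glb L i A" ..
qed

section \<open>Completeness of the integers and reals, incompleteness of the rationals\<close>

lemma lub_completeE:
  assumes "lub_complete I" "S \<subseteq> I" "S \<noteq> {}" "b \<in> I" "\<forall>x\<in>S. x \<le> b"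
  obtains l where "l \<in> I" "\<forall>x\<in>S. x \<le> l" "\<And>u. u \<in> I \<Longrightarrow> \<forall>x\<in>S. x \<le> u \<Longrightarrow> l \<le> u"
proof -
  have "\<exists>l\<in>I. (\<forall>x\<in>S. x \<le> l) \<and> (\<forall>u\<in>I. (\<forall>x\<in>S. x \<le> u) \<longrightarrow> l \<le> u)"
    using assms(1) unfolding lub_complete_def
    by (rule allE[of _ S], elim mp) (use assms in blast)
  then show thesis using that by blast
qed

text \<open>The floor of the real supremum works: an integer below the supremum is below its floor,
  and the floor does not exceed the supremum, hence no upper bound either.\<close>

lemma lub_complete_Ints: "lub_complete \<int>"
  unfolding lub_complete_def
proof (intro allI impI, elim conjE bexE)
  fix S :: "real set" and b
  assume S: "S \<subseteq> \<int>" "S \<noteq> {}" and b: "\<forall>x\<in>S. x \<le> b"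
  then have "bdd_above S" by (auto simp: bdd_above_def)
  let ?l = "of_int \<lfloor>Sup S\<rfloor> :: real"
  have "x \<le> ?l" if x: "x \<in> S" for x
  proof -
    have "x \<le> Sup S" using x \<open>bdd_above S\<close> by (rule cSup_upper)
    moreover obtain k where "x = of_int k" using S x by (auto elim: Ints_cases)
    ultimately show ?thesis by (simp add: le_floor_iff)
  qed
  moreover have "?l \<le> u" if "\<forall>x\<in>S. x \<le> u" for u
  proof -
    have "Sup S \<le> u" using \<open>S \<noteq> {}\<close> that by (blast intro: cSup_least)
    with of_int_floor_le show ?thesis by (rule order_trans)
  qed
  ultimately show "\<exists>l\<in>\<int>. (\<forall>x\<in>S. x \<le> l) \<and> (\<forall>u\<in>\<int>. (\<forall>x\<in>S. x \<le> u) \<longrightarrow> l \<le> u)"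
    by (intro bexI[of _ ?l]) auto
qed

lemma lub_complete_UNIV: "lub_complete UNIV"
  unfolding lub_complete_def
proof (intro allI impI, elim conjE bexE)
  fix S :: "real set" and b
  assume S: "S \<noteq> {}" and b: "\<forall>x\<in>S. x \<le> b"
  then have "bdd_above S" by (auto simp: bdd_above_def)
  with S show "\<exists>l\<in>UNIV. (\<forall>x\<in>S. x \<le> l) \<and> (\<forall>u\<in>UNIV. (\<forall>x\<in>S. x \<le> u) \<longrightarrow> l \<le> u)"
    by (intro bexI[of _ "Sup S"]) (auto intro: cSup_upper cSup_least)
qed

lemma not_lub_complete_Rats: "\<not> lub_complete \<rat>"
proof
  assume complete: "lub_complete \<rat>"
  \<comment> \<open>An irrational number exists because the rationals are countable and the reals
    are not.\<close>
  obtain r :: real where r: "r \<notin> \<rat>"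
    using countable_rat uncountable_UNIV_real by (metis UNIV_eq_I)
  define S where "S = {q \<in> \<rat>. q < r}"
  obtain p where "p \<in> \<rat>" "p < r"
    using Rats_dense_in_real[of "r - 1" r] by auto
  then have "S \<noteq> {}" by (auto simp: S_def)
  obtain b where "b \<in> \<rat>" "r < b"
    using Rats_dense_in_real[of r "r + 1"] by auto
  have "S \<subseteq> \<rat>" "\<forall>x\<in>S. x \<le> b" using \<open>r < b\<close> by (auto simp: S_def)
  then obtain l where l: "l \<in> \<rat>" "\<forall>x\<in>S. x \<le> l"
    "\<And>u. u \<in> \<rat> \<Longrightarrow> \<forall>x\<in>S. x \<le> u \<Longrightarrow> l \<le> u"
    using lub_completeE[OF complete _ \<open>S \<noteq> {}\<close> \<open>b \<in> \<rat>\<close>] by metis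
  have "l \<noteq> r" using l r by auto
  \<comment> \<open>A rational strictly between \<open>l\<close> and \<open>r\<close> is a member of
    \<open>S\<close> above \<open>l\<close> in the first case and an upper bound of \<open>S\<close>
    below \<open>l\<close> in the second.\<close>
  then consider "l < r" | "r < l" by linarith
  then show False
  proof cases
    case 1
    then obtain q where "q \<in> \<rat>" "l < q" "q < r" using Rats_dense_in_real by blast
    then show False using l(2) by (auto simp: S_def)
  next
    case 2
    then obtain q where "q \<in> \<rat>" "r < q" "q < l" using Rats_dense_in_real by blast
    then show False using l(3)[of q] by (auto simp: S_def)
  qed
qed

section \<open>Suprema in the extended number domain\<close>

lemma extend_inf_lub:
  assumes I: "lub_complete I" and A: "A \<subseteq> extend_inf I" "A \<noteq> {}"
  shows "\<exists>l\<in>extend_inf I. (\<forall>x\<in>A. x \<le> l) \<and> (\<forall>u\<in>extend_inf I. (\<forall>x\<in>A. x \<le> u) \<longrightarrow> l \<le> u)"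
proof (cases "\<exists>b\<in>I. \<forall>x\<in>A. x \<le> ereal b")
  case True
  then obtain b where b: "b \<in> I" "\<forall>x\<in>A. x \<le> ereal b" by blast
  \<comment> \<open>The real bound keeps \<open>\<infinity>\<close> out of \<open>A\<close>, so
    \<open>A\<close> is the image of a subset of \<open>I\<close> and completeness of
    \<open>I\<close> applies.\<close>
  define S where "S = {x \<in> I. ereal x \<in> A}"
  have A_eq: "A = ereal ` S"
  proof (intro equalityI subsetI)
    fix x assume x: "x \<in> A"
    then have "x \<in> extend_inf I" "x \<le> ereal b" using A(1) b(2) by auto
    then have "x \<in> ereal ` I" by (auto simp: extend_inf_def)
    with x show "x \<in> ereal ` S" by (auto simp: S_def)
  qed (auto simp: S_def)
  have "S \<subseteq> I" "S \<noteq> {}" "\<forall>x\<in>S. x \<le> b"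
    using A(2) b(2) by (simp_all add: A_eq) (simp add: S_def)
  then obtain l where "l \<in> I" "\<forall>x\<in>S. x \<le> l"
    "\<And>u. u \<in> I \<Longrightarrow> \<forall>x\<in>S. x \<le> u \<Longrightarrow> l \<le> u"
    using lub_completeE[OF I _ _ b(1)] by metis
  then show ?thesis
    by (intro bexI[of _ "ereal l"]) (auto simp: A_eq extend_inf_def)
next
  case False
  \<comment> \<open>Any upper bound other than \<open>\<infinity>\<close> would be a real one in
    \<open>I\<close>, so \<open>\<infinity>\<close> is the only upper bound.\<close>
  then show ?thesis
    by (intro bexI[of _ \<infinity>]) (auto simp: extend_inf_def)
qed

section \<open>The lattice of matrices with a new least element\<close>

lemma carrier_dbm_order: "carrier (dbm_order I) = insert None (Some ` dbms I)"
  by (simp add: dbm_order_def)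

lemma le_dbm_order: "le (dbm_order I) = dbm_bot_le"
  by (simp add: dbm_order_def)

lemma eq_dbm_order: "eq (dbm_order I) = (=)"
  by (simp add: dbm_order_def)

lemmas dbm_order_simps = carrier_dbm_order le_dbm_order eq_dbm_order

lemma dbm_bot_le_refl: "dbm_bot_le x x"
  by (cases x) (auto simp: dbm_le_def)

lemma dbm_bot_le_antisym: "dbm_bot_le x y \<Longrightarrow> dbm_bot_le y x \<Longrightarrow> x = y"
  by (cases x; cases y) (auto simp: dbm_le_def vec_eq_iff intro: antisym)

lemma dbm_bot_le_trans: "dbm_bot_le x y \<Longrightarrow> dbm_bot_le y z \<Longrightarrow> dbm_bot_le x z"
  by (cases x; cases y; cases z) (auto simp: dbm_le_def, meson order_trans)

lemma partial_order_dbm_order: "partial_order (dbm_order I)"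
  by unfold_locales
    (unfold dbm_order_simps,
      (erule (1) dbm_bot_le_antisym | blast intro: dbm_bot_le_refl dbm_bot_le_trans)+)

lemma dbm_bot_join_is_lub:
  assumes "x \<in> carrier (dbm_order I)" "y \<in> carrier (dbm_order I)"
  shows "is_lub (dbm_order I) (dbm_bot_join x y) {x, y}"
proof (rule least_UpperI)
  \<comment> \<open>Each entry of the maximum is an entry of one of the two matrices, so it stays in
    the domain whatever \<open>I\<close> is.\<close>
  show "dbm_bot_join x y \<in> carrier (dbm_order I)"
    using assms by (cases x; cases y) (auto simp: dbm_order_simps dbms_def dbm_max_def max_def)
next
  fix z assume "z \<in> {x, y}"
  then show "le (dbm_order I) z (dbm_bot_join x y)"
    by (cases x; cases y) (auto simp: dbm_order_simps dbm_le_def dbm_max_def)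
next
  fix z assume "z \<in> Upper (dbm_order I) {x, y}"
  then show "le (dbm_order I) (dbm_bot_join x y) z"
    using assms
    by (cases x; cases y; cases z) (auto simp: Upper_def dbm_order_simps dbm_le_def dbm_max_def)
qed (use assms in auto)

lemma dbm_bot_meet_is_glb:
  assumes "x \<in> carrier (dbm_order I)" "y \<in> carrier (dbm_order I)"
  shows "is_glb (dbm_order I) (dbm_bot_meet x y) {x, y}"
proof (rule greatest_LowerI)
  show "dbm_bot_meet x y \<in> carrier (dbm_order I)"
    using assms by (cases x; cases y) (auto simp: dbm_order_simps dbms_def dbm_min_def min_def)
next
  fix z assume "z \<in> {x, y}"
  then show "le (dbm_order I) (dbm_bot_meet x y) z"
    by (cases x; cases y) (auto simp: dbm_order_simps dbm_le_def dbm_min_def)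
next
  fix z assume "z \<in> Lower (dbm_order I) {x, y}"
  then show "le (dbm_order I) z (dbm_bot_meet x y)"
    using assms
    by (cases x; cases y; cases z) (auto simp: Lower_def dbm_order_simps dbm_le_def dbm_min_def)
qed (use assms in auto)

lemma lattice_dbm_order: "lattice (dbm_order I)"
proof -
  interpret partial_order "dbm_order I" by (rule partial_order_dbm_order)
  show ?thesis
    by unfold_locales (blast intro: dbm_bot_join_is_lub dbm_bot_meet_is_glb)+
qed

lemma least_dbm_order: "least (dbm_order I) None (carrier (dbm_order I))"
  by (auto simp: least_def dbm_order_simps)

lemma greatest_dbm_order: "greatest (dbm_order I) dbm_top (carrier (dbm_order I))"
  by (auto simp: greatest_def dbm_order_simps dbm_top_def dbms_def extend_inf_def dbm_le_def)

section \<open>Completeness of the lattice\<close>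

lemma dbm_order_lub_exists:
  fixes A :: "(ereal ^ 'n ^ 'n) option set"
  assumes I: "lub_complete I" and A: "A \<subseteq> carrier (dbm_order I)"
  shows "\<exists>s. is_lub (dbm_order I) s A"
proof (cases "A \<subseteq> {None}")
  case True
  \<comment> \<open>This covers the empty set, for which suprema of entries need not exist: the
    integers with \<open>\<infinity>\<close> have no least element.\<close>
  then have "is_lub (dbm_order I) None A"
    by (intro least_UpperI) (auto simp: dbm_order_simps)
  then show ?thesis ..
next
  case False
  \<comment> \<open>Dropping \<open>None\<close> does not change the upper bounds and leaves a
    non-empty set of matrices, so every position has a supremum.\<close>
  define M where "M = {m. Some m \<in> A}"
  have M: "M \<noteq> {}" "M \<subseteq> dbms I"
    using False A by (auto simp: M_def dbm_order_simps)
  have "\<exists>l\<in>extend_inf I. (\<forall>x\<in>(\<lambda>m. m $ i $ j) ` M. x \<le> l) \<and>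
      (\<forall>u\<in>extend_inf I. (\<forall>x\<in>(\<lambda>m. m $ i $ j) ` M. x \<le> u) \<longrightarrow> l \<le> u)" for i j
    using M by (intro extend_inf_lub[OF I]) (auto simp: dbms_def)
  then obtain l where l: "\<And>i j. l i j \<in> extend_inf I"
    "\<And>i j m. m \<in> M \<Longrightarrow> m $ i $ j \<le> l i j"
    "\<And>i j u. u \<in> extend_inf I \<Longrightarrow> (\<And>m. m \<in> M \<Longrightarrow> m $ i $ j \<le> u) \<Longrightarrow> l i j \<le> u"
    unfolding ball_simps by metis
  let ?s = "Some (\<chi> i j. l i j)"
  have "is_lub (dbm_order I) ?s A"
  proof (rule least_UpperI[OF _ _ A])
    show "?s \<in> carrier (dbm_order I)"
      using l(1) by (auto simp: dbm_order_simps dbms_def)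
  next
    fix x assume "x \<in> A"
    then show "le (dbm_order I) x ?s"
      using l(2) by (cases x) (auto simp: dbm_order_simps dbm_le_def M_def)
  next
    fix y assume y: "y \<in> Upper (dbm_order I) A"
    have above: "dbm_bot_le (Some m) y" if "m \<in> M" for m
      using y A that unfolding Upper_def M_def by (auto simp: le_dbm_order)
    \<comment> \<open>An upper bound of at least one matrix cannot be \<open>None\<close>.\<close>
    then obtain u where u: "y = Some u"
      using M(1) by (cases y) auto
    have "u \<in> dbms I" using y by (auto simp: Upper_def dbm_order_simps u)
    then show "le (dbm_order I) ?s y"
      using above l(3) by (auto simp: dbm_order_simps dbm_le_def dbms_def u)
  qed
  then show ?thesis ..
qed

text \<open>The backward direction takes suprema entrywise. The forward one reads a least upper
  bound of \<open>S\<close> off an entry of the supremum of the constant matrices over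
  \<open>S\<close>.\<close>

lemma complete_lattice_dbm_order_iff:
  "complete_lattice (dbm_order I :: (ereal ^ 'n ^ 'n) option gorder) \<longleftrightarrow> lub_complete I"
proof
  assume "lub_complete I"
  then show "complete_lattice (dbm_order I :: (ereal ^ 'n ^ 'n) option gorder)"
    using partial_order.complete_lattice_if_lubs[OF partial_order_dbm_order]
      dbm_order_lub_exists by blast
next
  assume "complete_lattice (dbm_order I :: (ereal ^ 'n ^ 'n) option gorder)"
  then interpret complete_lattice "dbm_order I :: (ereal ^ 'n ^ 'n) option gorder" .
  show "lub_complete I"
    unfolding lub_complete_def
  proof (intro allI impI, elim conjE bexE)
    fix S b assume S: "S \<subseteq> I" "S \<noteq> {}" and b: "b \<in> I" "\<forall>x\<in>S. x \<le> b"
    define const :: "real \<Rightarrow> (ereal ^ 'n ^ 'n) option" where "const x = Some (\<chi> i j. ereal x)" for x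
    have const_carrier: "const x \<in> carrier (dbm_order I)" if "x \<in> I" for x
      using that by (auto simp: const_def dbm_order_simps dbms_def extend_inf_def)
    have const_Upper: "const u \<in> Upper (dbm_order I) (const ` S)"
      if "u \<in> I" "\<forall>x\<in>S. x \<le> u" for u
      using that const_carrier[of u]
      by (intro Upper_memI) (auto simp: const_def dbm_order_simps dbm_le_def)
    have sub: "const ` S \<subseteq> carrier (dbm_order I)" using S const_carrier by blast
    obtain s where s: "is_lub (dbm_order I) s (const ` S)"
      using sup_exists[OF sub] by blast
    have above: "dbm_bot_le (const x) s" if "x \<in> S" for x
      using least_Upper_above[OF s _ sub] that by (auto simp: dbm_order_simps)
    have below: "dbm_bot_le s (const u)" if "u \<in> I" "\<forall>x\<in>S. x \<le> u" for u
      using least_le[OF s const_Upper[OF that]] by (simp add: dbm_order_simps)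
    obtain m where m: "s = Some m"
      using above S(2) by (cases s) (auto simp: const_def)
    \<comment> \<open>Any fixed position would do, since constant matrices compare the same way at
      every entry; \<open>undefined\<close> names an index of the type.\<close>
    define e where "e = m $ undefined $ undefined"
    have "m \<in> dbms I" using least_closed[OF s] by (auto simp: m dbm_order_simps)
    then have "e \<in> extend_inf I" by (auto simp: dbms_def e_def)
    have e_above: "ereal x \<le> e" if "x \<in> S" for x
      using above[OF that] by (auto simp: m const_def dbm_le_def e_def)
    have e_below: "e \<le> ereal u" if "u \<in> I" "\<forall>x\<in>S. x \<le> u" for u
      using below[OF that] by (auto simp: m const_def dbm_le_def e_def)
    \<comment> \<open>The bound \<open>b\<close> in \<open>I\<close> rules out
      \<open>e = \<infinity>\<close>.\<close>
    obtain l where "l \<in> I" "e = ereal l"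
      using \<open>e \<in> extend_inf I\<close> e_below[OF b] by (auto simp: extend_inf_def)
    then show "\<exists>l\<in>I. (\<forall>x\<in>S. x \<le> l) \<and> (\<forall>u\<in>I. (\<forall>x\<in>S. x \<le> u) \<longrightarrow> l \<le> u)"
      using e_above e_below by (intro bexI[of _ l]) auto
  qed
qed

theorem theorem15:
  fixes I :: "real set"
    and L :: "(ereal ^ 'n ^ 'n) option gorder"
  assumes I: "I \<in> {\<int>, \<rat>, UNIV}"
    and L: "L = dbm_order I"
  shows "(lattice L
      \<and> (\<forall>x\<in>carrier L. \<forall>y\<in>carrier L.
            is_lub L (dbm_bot_join x y) {x, y} \<and> is_glb L (dbm_bot_meet x y) {x, y})
      \<and> least L None (carrier L)
      \<and> greatest L dbm_top (carrier L))
    \<and> (lub_complete I \<longrightarrow> complete_lattice L)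
    \<and> (lub_complete \<int> \<and> lub_complete UNIV \<and> \<not> lub_complete \<rat>)
    \<and> (I = \<rat> \<longrightarrow> \<not> complete_lattice L)"
  unfolding L
  using lattice_dbm_order dbm_bot_join_is_lub dbm_bot_meet_is_glb least_dbm_order
    greatest_dbm_order complete_lattice_dbm_order_iff lub_complete_Ints lub_complete_UNIV
    not_lub_complete_Rats
  by blast

end
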